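(* Let $X$ be a metrizable space and let $n \geq 1$ be a natural number. If $AM(X)$ belongs to the absolute Borel class $\mathfrak{A}_n$, then $X$ belongs to $\mathfrak{M}_n$. Respectively, if $AM(X)$ belongs to the absolute Borel class $\mathfrak{M}_n$, then $X$ belongs to $\mathfrak{A}_n$.
   Context: For a metrizable space $X$, $C(X^2)$ denotes the space of continuous bounded real-valued functions on $X^2 = X \times X$, with the topology induced by the sup-metric $D(f,g) = \sup\{|f(x,y) - g(x,y)| \mid (x,y) \in X^2\}$. A metric on $X$ is admissible if it induces the given topology of $X$. $AM(X)$ denotes the subspace of $C(X^2)$ consisting of all bounded admissible metrics on $X$. Absolute Borel classes: for a metrizable space $Y$, let $\mathfrak{A}_0(Y)$ be the family of open subsets of $Y$ and $\mathfrak{M}_0(Y)$ the family of closed subsets of $Y$. For natural numbers $n \geq 1$ define inductively $$\mathfrak{A}_n(Y) = \Big\{\bigcup_{k \in \omega} A_k \ \Big|\ A_k \in \bigcup_{m < n} \mathfrak{M}_m(Y)\Big\}, \qquad \mathfrak{M}_n(Y) = \Big\{\bigcap_{k \in \omega} A_k \ \Big|\ A_k \in \bigcup_{m < n} \mathfrak{A}_m(Y)\Big\}.$$ The class $\mathfrak{A}_n$ (respectively, $\mathfrak{M}_n$) consists of the metrizable spaces $X$ such that $X \in \mathfrak{A}_n(Y)$ (respectively, $X \in \mathfrak{M}_n(Y)$) for every metrizable space $Y$ which contains $X$ as a subspace. *)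

theory Defs
  imports "HOL-Analysis.Analysis"
begin

declare SUP_cong [fundef_cong]

function borel_A :: "'a topology \<Rightarrow> nat \<Rightarrow> 'a set set"
  and borel_M :: "'a topology \<Rightarrow> nat \<Rightarrow> 'a set set" where
  "borel_A Y n = (if n = 0 then {U. openin Y U}
     else {\<Union>k. A k | A :: nat \<Rightarrow> 'a set. \<forall>k. A k \<in> (\<Union>m\<in>{..<n}. borel_M Y m)})"
| "borel_M Y n = (if n = 0 then {C. closedin Y C}
     else {\<Inter>k. A k | A :: nat \<Rightarrow> 'a set. \<forall>k. A k \<in> (\<Union>m\<in>{..<n}. borel_A Y m)})"
  by pat_completeness auto
termination
  by (relation "Wellfounded.measure (\<lambda>x. case x of Inl (Y, n) \<Rightarrow> n | Inr (Y, n) \<Rightarrow> n)") auto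

declare borel_A.simps [simp del] borel_M.simps [simp del]

text \<open>
  A formula cannot quantify over all metrizable spaces of all types, so the absolute classes carry
  the type \<open>'u\<close> of the points of the ambient spaces \<open>Y\<close> as a parameter. ``\<open>Y\<close> contains
  \<open>X\<close> as a subspace'' is rendered by a topological embedding \<open>e\<close> of \<open>X\<close> into \<open>Y\<close>.
  For \<open>n \<ge> 1\<close> and \<open>X\<close> with points of type \<open>'a\<close>, taking \<open>'u\<close> to be \<open>nat \<Rightarrow> 'a\<close> already gives
  the condition for every type whatsoever: see \<open>absolute_A_universal\<close> and
  \<open>absolute_M_universal\<close> below.
\<close>

definition absolute_A :: "'u itself \<Rightarrow> nat \<Rightarrow> 'a topology \<Rightarrow> bool" where
  "absolute_A _ n X \<longleftrightarrow> metrizable_space X \<and>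
     (\<forall>(Y :: 'u topology) e. metrizable_space Y \<and> embedding_map X Y e
        \<longrightarrow> e ` topspace X \<in> borel_A Y n)"

definition absolute_M :: "'u itself \<Rightarrow> nat \<Rightarrow> 'a topology \<Rightarrow> bool" where
  "absolute_M _ n X \<longleftrightarrow> metrizable_space X \<and>
     (\<forall>(Y :: 'u topology) e. metrizable_space Y \<and> embedding_map X Y e
        \<longrightarrow> e ` topspace X \<in> borel_M Y n)"

text \<open>
  Bounded continuous functions on \<open>X \<times> X\<close> are represented in \<^const>\<open>cfunspace\<close> by functions that
  are \<^const>\<open>undefined\<close> off \<open>topspace X \<times> topspace X\<close>; hence the restriction, which also makes
  the values of \<open>d\<close> outside the carrier irrelevant.
\<close>

definition bounded_admissible_metrics :: "'a topology \<Rightarrow> ('a \<times> 'a \<Rightarrow> real) set" where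
  "bounded_admissible_metrics X =
     {restrict (\<lambda>(x, y). d x y) (topspace X \<times> topspace X) | d.
        Metric_space (topspace X) d \<and> Metric_space.mtopology (topspace X) d = X \<and>
        (\<exists>B. \<forall>x\<in>topspace X. \<forall>y\<in>topspace X. d x y \<le> B)}"

definition AM :: "'a topology \<Rightarrow> ('a \<times> 'a \<Rightarrow> real) topology" where
  "AM X = subtopology (mtopology_of (cfunspace (prod_topology X X) euclidean_metric))
            (bounded_admissible_metrics X)"

lemma borel_0:
  "borel_A Y 0 = {U. openin Y U}" "borel_M Y 0 = {C. closedin Y C}"
  by (simp_all add: borel_A.simps[of Y 0] borel_M.simps[of Y 0])

lemma borel_A_pos:
  "n \<noteq> 0 \<Longrightarrow> S \<in> borel_A Y n \<longleftrightarrow>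
     (\<exists>A :: nat \<Rightarrow> _. S = (\<Union>k. A k) \<and> (\<forall>k. \<exists>m<n. A k \<in> borel_M Y m))"
  by (subst borel_A.simps) (simp add: Bex_def)

lemma borel_M_pos:
  "n \<noteq> 0 \<Longrightarrow> S \<in> borel_M Y n \<longleftrightarrow>
     (\<exists>A :: nat \<Rightarrow> _. S = (\<Inter>k. A k) \<and> (\<forall>k. \<exists>m<n. A k \<in> borel_A Y m))"
  by (subst borel_M.simps) (simp add: Bex_def)

lemma borel_A_posE:
  assumes "S \<in> borel_A Y n" "n \<noteq> 0"
  obtains A :: "nat \<Rightarrow> _" where "S = (\<Union>k. A k)" "\<And>k. \<exists>m<n. A k \<in> borel_M Y m"
  using iffD1[OF borel_A_pos[OF assms(2)] assms(1)] by blast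

lemma borel_M_posE:
  assumes "S \<in> borel_M Y n" "n \<noteq> 0"
  obtains A :: "nat \<Rightarrow> _" where "S = (\<Inter>k. A k)" "\<And>k. \<exists>m<n. A k \<in> borel_A Y m"
  using iffD1[OF borel_M_pos[OF assms(2)] assms(1)] by blast

lemma bounded_admissible_metrics_subset:
  "bounded_admissible_metrics X \<subseteq> mspace (cfunspace (prod_topology X X) euclidean_metric)"
proof
  fix f assume "f \<in> bounded_admissible_metrics X"
  then obtain d B where f: "f = restrict (\<lambda>(x, y). d x y) (topspace X \<times> topspace X)"
    and M: "Metric_space (topspace X) d" and top: "Metric_space.mtopology (topspace X) d = X"
    and B: "\<And>x y. x \<in> topspace X \<Longrightarrow> y \<in> topspace X \<Longrightarrow> d x y \<le> B"
    by (auto simp: bounded_admissible_metrics_def)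
  interpret Metric_space "topspace X" d by fact
  have "continuous_map (prod_topology X X) euclideanreal (\<lambda>p. d (fst p) (snd p))"
    using continuous_map_mdist[of "prod_topology X X" "metric (topspace X, d)" fst snd]
    by (simp add: M Metric_space.mspace_metric top mtopology_of_def
        Metric_space.mdist_metric continuous_map_fst continuous_map_snd)
  then have "continuous_map (prod_topology X X) euclideanreal f"
    by (rule continuous_map_eq) (auto simp: f)
  moreover have "bounded (f ` (topspace X \<times> topspace X))"
    unfolding bounded_iff using B by (intro exI[of _ B]) (auto simp: f)
  moreover have "f \<in> extensional (topspace X \<times> topspace X)"
    by (simp add: f)
  ultimately show "f \<in> mspace (cfunspace (prod_topology X X) euclidean_metric)"
    by simp
qed

corollary topspace_AM: "topspace (AM X) = bounded_admissible_metrics X"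
  using bounded_admissible_metrics_subset[of X] by (auto simp: AM_def)

lemma borel_subset_topspace:
  "(S \<in> borel_A Y n \<longrightarrow> S \<subseteq> topspace Y) \<and> (S \<in> borel_M Y n \<longrightarrow> S \<subseteq> topspace Y)"
proof (induction n arbitrary: S rule: less_induct)
  case (less n)
  show ?case
  proof (cases "n = 0")
    case True
    then show ?thesis
      by (simp add: borel_0 openin_subset closedin_subset)
  next
    case False
    have "S \<subseteq> topspace Y" if hyp: "S \<in> borel_A Y n"
    proof -
      obtain A :: "nat \<Rightarrow> _" where S: "S = (\<Union>k. A k)" and A: "\<And>k. \<exists>m<n. A k \<in> borel_M Y m"
        using borel_A_posE[OF hyp False] by blast
      have "A k \<subseteq> topspace Y" for k using A less by blast
      then show ?thesis using S by blast
    qed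
    moreover have "S \<subseteq> topspace Y" if hyp: "S \<in> borel_M Y n"
    proof -
      obtain A :: "nat \<Rightarrow> _" where S: "S = (\<Inter>k. A k)" and A: "\<And>k. \<exists>m<n. A k \<in> borel_A Y m"
        using borel_M_posE[OF hyp False] by blast
      have "A k \<subseteq> topspace Y" for k using A less by blast
      then show ?thesis using S by blast
    qed
    ultimately show ?thesis by blast
  qed
qed

lemma homeomorphic_map_borel:
  assumes h: "homeomorphic_map Y Z h"
  shows "(S \<in> borel_A Y n \<longrightarrow> h ` S \<in> borel_A Z n) \<and> (S \<in> borel_M Y n \<longrightarrow> h ` S \<in> borel_M Z n)"
proof (induction n arbitrary: S rule: less_induct)
  case (less n)
  show ?case
  proof (cases "n = 0")
    case True
    then show ?thesis
      using homeomorphic_map_openness_eq[OF h] homeomorphic_map_closedness_eq[OF h]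
      by (auto simp: borel_0)
  next
    case False
    have "h ` S \<in> borel_A Z n" if hyp: "S \<in> borel_A Y n"
    proof -
      obtain A :: "nat \<Rightarrow> _" where S: "S = (\<Union>k. A k)" and A: "\<And>k. \<exists>m<n. A k \<in> borel_M Y m"
        using borel_A_posE[OF hyp False] by blast
      have "\<forall>k. \<exists>m<n. h ` A k \<in> borel_M Z m"
        using A less by metis
      moreover have "h ` S = (\<Union>k. h ` A k)" using S by auto
      ultimately show ?thesis
        unfolding borel_A_pos[OF False] by blast
    qed
    moreover have "h ` S \<in> borel_M Z n" if hyp: "S \<in> borel_M Y n"
    proof -
      obtain A :: "nat \<Rightarrow> _" where S: "S = (\<Inter>k. A k)" and A: "\<And>k. \<exists>m<n. A k \<in> borel_A Y m"
        using borel_M_posE[OF hyp False] by blast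
      have "\<forall>k. \<exists>m<n. h ` A k \<in> borel_A Z m"
        using A less by metis
      moreover have "h ` S = (\<Inter>k. h ` A k)"
        unfolding S
      proof (rule image_INT[of h "topspace Y"])
        show "inj_on h (topspace Y)" using h homeomorphic_map_def by blast
        show "\<forall>k\<in>UNIV. A k \<subseteq> topspace Y" using A borel_subset_topspace by blast
      qed auto
      ultimately show ?thesis
        unfolding borel_M_pos[OF False] by blast
    qed
    ultimately show ?thesis by blast
  qed
qed

lemma borel_closed_subspace:
  assumes Y: "metrizable_space Y" and C: "closedin Y C"
  shows "(S \<in> borel_A (subtopology Y C) n \<longrightarrow> n \<ge> 1 \<longrightarrow> S \<in> borel_A Y n) \<and>
         (S \<in> borel_M (subtopology Y C) n \<longrightarrow> S \<in> borel_M Y n)"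
proof (induction n arbitrary: S rule: less_induct)
  case (less n)
  show ?case
  proof (cases "n = 0")
    case True
    then show ?thesis
      using C closedin_closed_subtopology by (auto simp: borel_0)
  next
    case False
    have "S \<in> borel_A Y n" if hyp: "S \<in> borel_A (subtopology Y C) n"
    proof -
      obtain A :: "nat \<Rightarrow> _" where S: "S = (\<Union>k. A k)"
        and A: "\<And>k. \<exists>m<n. A k \<in> borel_M (subtopology Y C) m"
        using borel_A_posE[OF hyp False] by blast
      have "\<forall>k. \<exists>m<n. A k \<in> borel_M Y m"
        using A less by metis
      then show ?thesis
        using S unfolding borel_A_pos[OF False] by blast
    qed
    moreover have "S \<in> borel_M Y n" if hyp: "S \<in> borel_M (subtopology Y C) n"
    proof -
      obtain A :: "nat \<Rightarrow> _" where S: "S = (\<Inter>k. A k)"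
        and A: "\<And>k. \<exists>m<n. A k \<in> borel_A (subtopology Y C) m"
        using borel_M_posE[OF hyp False] by blast
      have "\<exists>B m. m < n \<and> B \<in> borel_A Y m \<and> A k = B \<inter> C" for k
      proof -
        obtain m where m: "m < n" "A k \<in> borel_A (subtopology Y C) m" using A by blast
        show ?thesis
        proof (cases "m = 0")
          case True
          then have "openin (subtopology Y C) (A k)"
            using m by (simp add: borel_0)
          then obtain U where "openin Y U" "A k = U \<inter> C" by (auto simp: openin_subtopology)
          then show ?thesis
            using m True by (intro exI[of _ U] exI[of _ 0]) (simp add: borel_0)
        next
          case False
          then have "A k \<in> borel_A Y m" using m less by auto
          moreover have "A k \<subseteq> C"
            using m borel_subset_topspace[of "A k" "subtopology Y C" m] by auto
          ultimately show ?thesis using m by blast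
        qed
      qed
      then obtain B where B: "\<And>k. \<exists>m<n. B k \<in> borel_A Y m" "\<And>k. A k = B k \<inter> C"
        by metis
      have "gdelta_in Y C" using Y C closed_imp_gdelta_in by blast
      then obtain V :: "nat \<Rightarrow> _" where V: "\<And>k. openin Y (V k)" "(\<Inter>k. V k) = C"
        unfolding gdelta_in_descending by metis
      define W where "W k = (if even k then B (k div 2) else V (k div 2))" for k
      have "\<forall>k. \<exists>m<n. W k \<in> borel_A Y m"
      proof
        fix k
        have "V (k div 2) \<in> borel_A Y 0" using V by (simp add: borel_0)
        then show "\<exists>m<n. W k \<in> borel_A Y m"
          using B(1)[of "k div 2"] False by (auto simp: W_def)
      qed
      moreover have "S = (\<Inter>k. W k)"
      proof -
        have "(\<Inter>k. W k) = (\<Inter>k. B k) \<inter> (\<Inter>k. V k)"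
        proof (intro equalityI subsetI)
          fix x assume x: "x \<in> (\<Inter>k. W k)"
          have "x \<in> B k" "x \<in> V k" for k
            using x INT_D[OF x, of "2 * k"] INT_D[OF x, of "2 * k + 1"] by (auto simp: W_def)
          then show "x \<in> (\<Inter>k. B k) \<inter> (\<Inter>k. V k)" by blast
        qed (auto simp: W_def)
        then show ?thesis using S B(2) V(2) by auto
      qed
      ultimately show ?thesis
        unfolding borel_M_pos[OF False] by blast
    qed
    ultimately show ?thesis by blast
  qed
qed

text \<open>
  The closure of a copy of \<open>X\<close> in a metrizable space has, up to homeomorphism, points of type
  \<open>nat \<Rightarrow> 'a\<close> (sequences in \<open>X\<close>).
\<close>

lemma closure_embedding_representation:
  fixes X :: "'a topology" and Y :: "'b topology"
  assumes Y: "metrizable_space Y" and e: "embedding_map X Y e"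
  obtains Z :: "(nat \<Rightarrow> 'a) topology" and h
  where "metrizable_space Z"
    and "homeomorphic_map Z (subtopology Y (Y closure_of (e ` topspace X))) h"
proof -
  let ?E = "e ` topspace X"
  define T where "T = subtopology Y (Y closure_of ?E)"
  obtain M d where M: "Metric_space M d" and Yd: "Y = Metric_space.mtopology M d"
    using Y by (auto simp: metrizable_space_def)
  interpret Metric_space M d by fact
  have topT: "topspace T = Y closure_of ?E"
    by (simp add: T_def closure_of_subset_topspace inf.absorb2)
  have "\<exists>\<sigma>. range \<sigma> \<subseteq> ?E \<and> limitin mtopology \<sigma> y sequentially" if "y \<in> topspace T" for y
    using that unfolding topT Yd closure_of_sequentially by blast
  then obtain \<sigma> where \<sigma>: "\<And>y. y \<in> topspace T \<Longrightarrow> range (\<sigma> y) \<subseteq> ?E"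
    "\<And>y. y \<in> topspace T \<Longrightarrow> limitin mtopology (\<sigma> y) y sequentially"
    by metis
  define g where "g y = inv_into (topspace X) e \<circ> \<sigma> y" for y
  have inj: "inj_on g (topspace T)"
  proof (rule inj_onI)
    fix y z assume yz: "y \<in> topspace T" "z \<in> topspace T" "g y = g z"
    have "\<sigma> y i = \<sigma> z i" for i
    proof -
      have "\<sigma> y i \<in> ?E" "\<sigma> z i \<in> ?E" using \<sigma>(1) yz by blast+
      moreover have "inv_into (topspace X) e (\<sigma> y i) = inv_into (topspace X) e (\<sigma> z i)"
        using fun_cong[OF yz(3), of i] by (simp add: g_def)
      ultimately show ?thesis by (metis f_inv_into_f)
    qed
    then have "\<sigma> y = \<sigma> z" by blast
    then show "y = z"
      using \<sigma>(2) yz limitin_metric_unique by (metis trivial_limit_sequentially)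
  qed
  define h where "h = inv_into (topspace T) g"
  define Z where "Z = pullback_topology (g ` topspace T) h T"
  have hg: "h (g y) = y" if "y \<in> topspace T" for y
    using that inj by (simp add: h_def)
  have topZ: "topspace Z = g ` topspace T"
    using hg by (auto simp: Z_def topspace_pullback_topology)
  have "homeomorphic_map Z T h"
  proof (rule bijective_open_imp_homeomorphic_map)
    show "continuous_map Z T h"
      using continuous_map_pullback[of T T id "g ` topspace T" h] by (simp add: Z_def)
    show "open_map Z T h"
      unfolding open_map_def
    proof (intro allI impI)
      fix U assume "openin Z U"
      then obtain V where V: "openin T V" "U = h -` V \<inter> g ` topspace T"
        by (auto simp: Z_def openin_pullback_topology)
      have "h ` U = V"
        using openin_subset[OF V(1)] hg by (force simp: V(2))
      then show "openin T (h ` U)" using V by simp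
    qed
    show "h ` topspace Z = topspace T" using hg by (force simp: topZ)
    show "inj_on h (topspace Z)" using hg by (auto simp: topZ inj_on_def)
  qed
  moreover have "metrizable_space Z"
  proof -
    have "metrizable_space T" by (simp add: T_def Y metrizable_space_subtopology)
    then show ?thesis
      using \<open>homeomorphic_map Z T h\<close> homeomorphic_map_imp_homeomorphic_space
        homeomorphic_metrizable_space by blast
  qed
  ultimately show thesis using that unfolding T_def by blast
qed

lemma embedding_transfer:
  fixes X :: "'a topology" and Y :: "'b topology"
  assumes Y: "metrizable_space Y" and e: "embedding_map X Y e"
  obtains Z :: "(nat \<Rightarrow> 'a) topology" and h e' C
  where "metrizable_space Z" "embedding_map X Z e'" "closedin Y C"
    "homeomorphic_map Z (subtopology Y C) h" "h ` e' ` topspace X = e ` topspace X"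
proof -
  define C where "C = Y closure_of (e ` topspace X)"
  obtain Z :: "(nat \<Rightarrow> 'a) topology" and h where Z: "metrizable_space Z"
    and h: "homeomorphic_map Z (subtopology Y C) h"
    using closure_embedding_representation[OF Y e] unfolding C_def by blast
  obtain h' where h': "homeomorphic_maps Z (subtopology Y C) h h'"
    using h homeomorphic_map_maps by blast
  have EY: "e ` topspace X \<subseteq> topspace Y"
    using homeomorphic_imp_surjective_map[OF e[unfolded embedding_map_def]]
    by (metis inf_le1 topspace_subtopology)
  have EC: "e ` topspace X \<subseteq> C"
    unfolding C_def by (rule closure_of_subset[OF EY])
  have "embedding_map X (subtopology Y C) e"
    using e EC by (simp add: embedding_map_in_subtopology)
  moreover have "embedding_map (subtopology Y C) Z h'"
    using h' homeomorphic_maps_map surjective_embedding_map by metis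
  ultimately have "embedding_map X Z (h' \<circ> e)"
    by (rule embedding_map_compose)
  moreover have "h ` (h' \<circ> e) ` topspace X = e ` topspace X"
  proof -
    have "h (h' y) = y" if "y \<in> e ` topspace X" for y
      using h' that EC EY by (auto simp: homeomorphic_maps_def)
    then show ?thesis by (force simp: image_image)
  qed
  moreover have "closedin Y C" by (simp add: C_def)
  ultimately show thesis using Z h that by blast
qed

theorem absolute_A_universal:
  fixes X :: "'a topology"
  assumes "n \<ge> 1" and X: "absolute_A TYPE(nat \<Rightarrow> 'a) n X"
  shows "absolute_A TYPE('b) n X"
  unfolding absolute_A_def
proof (intro conjI allI impI)
  show "metrizable_space X" using X by (simp add: absolute_A_def)
  fix Y :: "'b topology" and e
  assume asm: "metrizable_space Y \<and> embedding_map X Y e"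
  then obtain Z :: "(nat \<Rightarrow> 'a) topology" and h e' C where
    Z: "metrizable_space Z" "embedding_map X Z e'" and C: "closedin Y C"
    and h: "homeomorphic_map Z (subtopology Y C) h"
    and eq: "h ` e' ` topspace X = e ` topspace X"
    using embedding_transfer by metis
  have "e' ` topspace X \<in> borel_A Z n" using X Z by (simp add: absolute_A_def)
  then have "e ` topspace X \<in> borel_A (subtopology Y C) n"
    using homeomorphic_map_borel[OF h] eq by metis
  then show "e ` topspace X \<in> borel_A Y n"
    using borel_closed_subspace[OF _ C] asm \<open>n \<ge> 1\<close> by blast
qed

theorem absolute_M_universal:
  fixes X :: "'a topology"
  assumes X: "absolute_M TYPE(nat \<Rightarrow> 'a) n X"
  shows "absolute_M TYPE('b) n X"
  unfolding absolute_M_def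
proof (intro conjI allI impI)
  show "metrizable_space X" using X by (simp add: absolute_M_def)
  fix Y :: "'b topology" and e
  assume asm: "metrizable_space Y \<and> embedding_map X Y e"
  then obtain Z :: "(nat \<Rightarrow> 'a) topology" and h e' C where
    Z: "metrizable_space Z" "embedding_map X Z e'" and C: "closedin Y C"
    and h: "homeomorphic_map Z (subtopology Y C) h"
    and eq: "h ` e' ` topspace X = e ` topspace X"
    using embedding_transfer by metis
  have "e' ` topspace X \<in> borel_M Z n" using X Z by (simp add: absolute_M_def)
  then have "e ` topspace X \<in> borel_M (subtopology Y C) n"
    using homeomorphic_map_borel[OF h] eq by metis
  then show "e ` topspace X \<in> borel_M Y n"
    using borel_closed_subspace[OF _ C] asm by blast
qed

end

theory Submission
  imports Defs
begin

text \<open>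
  Embed \<open>X\<close> in a metrizable space \<open>Y\<close>, with image \<open>S\<close>. If \<open>S\<close> is closed, it lies in all the
  classes in question. Otherwise it suffices to find a continuous map \<open>\<Phi>\<close> from \<open>Y\<close> to the space of
  bounded continuous functions on \<open>X \<times> X\<close> such that \<open>\<Phi> y\<close> is an admissible metric exactly when
  \<open>y \<notin> S\<close>. Then the complement of \<open>S\<close> is the preimage of \<open>AM X\<close>, hence inherits its Borel class,
  and passing to complements exchanges \<open>borel_A\<close> and \<open>borel_M\<close>.

  To define \<open>\<Phi>\<close>, choose a metric \<open>d \<le> 1\<close> for \<open>Y\<close> and a point \<open>p\<close> in the closure of \<open>S\<close> but not in
  \<open>S\<close>. Glue the points \<open>y\<close> and \<open>p\<close> of \<open>Y\<close> together: the distance of \<open>u\<close> and \<open>v\<close> becomes the length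
  of the shortest path that may jump from \<open>y\<close> to \<open>p\<close> or back for free. Let \<open>\<Phi> y\<close> be the restriction
  of this pseudometric to \<open>S\<close>, transported to \<open>X\<close>. It is a \<open>1\<close>-Lipschitz function of \<open>y\<close>.

  If \<open>y \<notin> S\<close>, then a path through the glued point has to cover at least the distance from its start
  \<open>u \<in> S\<close> to \<open>{y, p}\<close>, which is positive. So near \<open>u\<close> nothing has changed, and \<open>\<Phi> y\<close> is an
  admissible metric (\<open>glued_metric_map_admissible\<close>). If \<open>y \<in> S\<close>, then points of \<open>S\<close> that approach
  \<open>p\<close> in \<open>Y\<close> converge to \<open>y\<close> for the glued distance but not in \<open>S\<close>, so \<open>\<Phi> y\<close> is not admissible
  (\<open>glued_metric_map_not_admissible\<close>).
\<close>


section \<open>Borel classes of subsets\<close>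

lemma borel_classes_preimage:
  assumes f: "continuous_map Y Z f"
  shows "(S \<in> borel_A Z n \<longrightarrow> {y \<in> topspace Y. f y \<in> S} \<in> borel_A Y n) \<and>
         (S \<in> borel_M Z n \<longrightarrow> {y \<in> topspace Y. f y \<in> S} \<in> borel_M Y n)"
proof (induction n arbitrary: S rule: less_induct)
  case (less n)
  show ?case
  proof (cases "n = 0")
    case True
    then show ?thesis
      using openin_continuous_map_preimage[OF f] closedin_continuous_map_preimage[OF f]
      by (auto simp: borel_0)
  next
    case False
    have "{y \<in> topspace Y. f y \<in> S} \<in> borel_A Y n" if hyp: "S \<in> borel_A Z n"
    proof -
      obtain A :: "nat \<Rightarrow> _" where S: "S = (\<Union>k. A k)" and A: "\<And>k. \<exists>m<n. A k \<in> borel_M Z m"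
        using borel_A_posE[OF hyp False] by blast
      have "\<forall>k. \<exists>m<n. {y \<in> topspace Y. f y \<in> A k} \<in> borel_M Y m"
        using A less by metis
      moreover have "{y \<in> topspace Y. f y \<in> S} = (\<Union>k. {y \<in> topspace Y. f y \<in> A k})"
        using S by auto
      ultimately show ?thesis
        unfolding borel_A_pos[OF False] by blast
    qed
    moreover have "{y \<in> topspace Y. f y \<in> S} \<in> borel_M Y n" if hyp: "S \<in> borel_M Z n"
    proof -
      obtain A :: "nat \<Rightarrow> _" where S: "S = (\<Inter>k. A k)" and A: "\<And>k. \<exists>m<n. A k \<in> borel_A Z m"
        using borel_M_posE[OF hyp False] by blast
      have "\<forall>k. \<exists>m<n. {y \<in> topspace Y. f y \<in> A k} \<in> borel_A Y m"
        using A less by metis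
      moreover have "{y \<in> topspace Y. f y \<in> S} = (\<Inter>k. {y \<in> topspace Y. f y \<in> A k})"
        using S by auto
      ultimately show ?thesis
        unfolding borel_M_pos[OF False] by blast
    qed
    ultimately show ?thesis by blast
  qed
qed

lemma borel_classes_complement:
  "(S \<in> borel_A Y n \<longrightarrow> topspace Y - S \<in> borel_M Y n) \<and>
   (S \<in> borel_M Y n \<longrightarrow> topspace Y - S \<in> borel_A Y n)"
proof (induction n arbitrary: S rule: less_induct)
  case (less n)
  show ?case
  proof (cases "n = 0")
    case True
    then show ?thesis by (auto simp: borel_0)
  next
    case False
    have "topspace Y - S \<in> borel_M Y n" if hyp: "S \<in> borel_A Y n"
    proof -
      obtain A :: "nat \<Rightarrow> _" where S: "S = (\<Union>k. A k)" and A: "\<And>k. \<exists>m<n. A k \<in> borel_M Y m"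
        using borel_A_posE[OF hyp False] by blast
      have "\<forall>k. \<exists>m<n. topspace Y - A k \<in> borel_A Y m"
        using A less by metis
      moreover have "topspace Y - S = (\<Inter>k. topspace Y - A k)"
        using S by auto
      ultimately show ?thesis
        unfolding borel_M_pos[OF False] by blast
    qed
    moreover have "topspace Y - S \<in> borel_A Y n" if hyp: "S \<in> borel_M Y n"
    proof -
      obtain A :: "nat \<Rightarrow> _" where S: "S = (\<Inter>k. A k)" and A: "\<And>k. \<exists>m<n. A k \<in> borel_A Y m"
        using borel_M_posE[OF hyp False] by blast
      have "\<forall>k. \<exists>m<n. topspace Y - A k \<in> borel_M Y m"
        using A less by metis
      moreover have "topspace Y - S = (\<Union>k. topspace Y - A k)"
        using S by auto
      ultimately show ?thesis
        unfolding borel_A_pos[OF False] by blast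
    qed
    ultimately show ?thesis by blast
  qed
qed

lemma closedin_imp_borel_A:
  assumes "closedin Y S" and "n \<ge> 1"
  shows "S \<in> borel_A Y n"
proof -
  have n: "n \<noteq> 0" using assms(2) by simp
  show ?thesis
    unfolding borel_A_pos[OF n]
    using assms by (intro exI[of _ "\<lambda>k. S"]) (auto simp: borel_0 intro!: exI[of _ "0::nat"])
qed

lemma closedin_imp_borel_M:
  assumes Y: "metrizable_space Y" and S: "closedin Y S" and n: "n \<ge> 1"
  shows "S \<in> borel_M Y n"
proof -
  have n0: "n \<noteq> 0" using n by simp
  have "gdelta_in Y S" using Y S closed_imp_gdelta_in by blast
  then obtain V :: "nat \<Rightarrow> _" where "\<And>k. openin Y (V k)" "(\<Inter>k. V k) = S"
    unfolding gdelta_in_descending by metis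
  then show ?thesis
    unfolding borel_M_pos[OF n0]
    using n by (intro exI[of _ V]) (auto simp: borel_0 intro!: exI[of _ "0::nat"])
qed


section \<open>Gluing two points of a metric space\<close>

lemma pullback_metric:
  assumes N: "Metric_space N \<delta>"
    and e: "homeomorphic_map X (Metric_space.mtopology N \<delta>) e"
  shows "Metric_space (topspace X) (\<lambda>x x'. \<delta> (e x) (e x'))"
    and "Metric_space.mtopology (topspace X) (\<lambda>x x'. \<delta> (e x) (e x')) = X"
proof -
  interpret N: Metric_space N \<delta> by fact
  have im: "e ` topspace X = N"
    using homeomorphic_imp_surjective_map[OF e] by simp
  have eN: "e x \<in> N" if "x \<in> topspace X" for x using im that by blast
  have inj: "inj_on e (topspace X)" using e homeomorphic_imp_injective_map by blast
  show M: "Metric_space (topspace X) (\<lambda>x x'. \<delta> (e x) (e x'))"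
    by unfold_locales (auto simp: N.commute eN inj inj_on_eq_iff[OF inj] intro: N.triangle)
  interpret X: Metric_space "topspace X" "\<lambda>x x'. \<delta> (e x) (e x')" by fact
  have ball: "e ` X.mball x r = N.mball (e x) r" if "x \<in> topspace X" for x r
  proof
    show "e ` X.mball x r \<subseteq> N.mball (e x) r" using that eN by auto
    show "N.mball (e x) r \<subseteq> e ` X.mball x r"
    proof
      fix z assume z: "z \<in> N.mball (e x) r"
      then have "z \<in> e ` topspace X" unfolding im by simp
      then obtain x' where "x' \<in> topspace X" "z = e x'" by blast
      then show "z \<in> e ` X.mball x r" using z that by simp
    qed
  qed
  show "X.mtopology = X"
  proof (rule topology_eq[THEN iffD2], intro allI)
    fix U
    show "openin X.mtopology U \<longleftrightarrow> openin X U"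
    proof (cases "U \<subseteq> topspace X")
      case True
      have "openin X U \<longleftrightarrow> openin N.mtopology (e ` U)"
        using homeomorphic_map_openness[OF e True] by simp
      also have "\<dots> \<longleftrightarrow> (\<forall>x\<in>U. \<exists>r>0. N.mball (e x) r \<subseteq> e ` U)"
        using True eN by (auto simp: N.openin_mtopology)
      also have "\<dots> \<longleftrightarrow> (\<forall>x\<in>U. \<exists>r>0. X.mball x r \<subseteq> U)"
      proof (rule ball_cong[OF refl])
        fix x assume "x \<in> U"
        then have "N.mball (e x) r \<subseteq> e ` U \<longleftrightarrow> X.mball x r \<subseteq> U" for r
          using True inj_on_image_subset_iff[OF inj X.mball_subset_mspace True]
          by (simp add: subsetD flip: ball)
        then show "(\<exists>r>0. N.mball (e x) r \<subseteq> e ` U) \<longleftrightarrow> (\<exists>r>0. X.mball x r \<subseteq> U)" by simp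
      qed
      also have "\<dots> \<longleftrightarrow> openin X.mtopology U"
        using True by (auto simp: X.openin_mtopology)
      finally show ?thesis by simp
    next
      case False
      then show ?thesis using openin_subset[of X U] openin_subset[of X.mtopology U] by auto
    qed
  qed
qed

context Metric_space
begin

text \<open>
  At most one jump between \<open>y\<close> and \<open>p\<close> is considered, because a path with two jumps passes through
  the same one of these points twice, and the loop in between can be omitted.
\<close>

definition glued_dist :: "'a \<Rightarrow> 'a \<Rightarrow> 'a \<Rightarrow> 'a \<Rightarrow> real" where
  "glued_dist y p u v = min (d u v) (min (d u y + d p v) (d u p + d y v))"

lemma glued_dist_triangle:
  assumes "y \<in> M" "p \<in> M" "u \<in> M" "v \<in> M" "w \<in> M"
  shows "glued_dist y p u w \<le> glued_dist y p u v + glued_dist y p v w"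
proof -
  have cases: "glued_dist y p a b = d a b \<or> glued_dist y p a b = d a y + d p b \<or>
      glued_dist y p a b = d a p + d y b" for a b
    by (simp add: glued_dist_def min_def)
  have le: "glued_dist y p u w \<le> d u w" "glued_dist y p u w \<le> d u y + d p w"
    "glued_dist y p u w \<le> d u p + d y w"
    by (simp_all add: glued_dist_def)
  have tri: "d u w \<le> d u v + d v w" "d u y \<le> d u v + d v y" "d u p \<le> d u v + d v p"
    "d y w \<le> d y v + d v w" "d p w \<le> d p v + d v w" "d u w \<le> d u y + d y w" "d u w \<le> d u p + d p w"
    using assms by (simp_all add: triangle)
  have nn: "d p v \<ge> 0" "d v y \<ge> 0" "d y v \<ge> 0" "d v p \<ge> 0"
    by simp_all
  show ?thesis
    using cases[of u v] cases[of v w] by (elim disjE; use le tri nn in linarith)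
qed

lemma Metric_space_glued_dist:
  assumes "y \<in> M - S" "p \<in> M - S" "S \<subseteq> M"
  shows "Metric_space S (glued_dist y p)"
proof
  show "0 \<le> glued_dist y p u v" for u v
    by (simp add: glued_dist_def)
  show "glued_dist y p u v = glued_dist y p v u" for u v
    unfolding glued_dist_def by (metis add.commute commute min.commute)
  fix u v assume uv: "u \<in> S" "v \<in> S"
  have "d u y > 0" "d u p > 0" using assms uv by auto
  then have "d u y + d p v > 0" "d u p + d y v > 0"
    by (auto intro: add_pos_nonneg)
  moreover have "d u v = 0 \<longleftrightarrow> u = v" using zero[of u v] uv assms(3) by blast
  ultimately show "glued_dist y p u v = 0 \<longleftrightarrow> u = v"
    unfolding glued_dist_def min_def using nonneg[of u v] by auto
next
  fix u v w assume "u \<in> S" "v \<in> S" "w \<in> S"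
  then show "glued_dist y p u w \<le> glued_dist y p u v + glued_dist y p v w"
    using assms by (intro glued_dist_triangle) auto
qed

text \<open>
  Around \<open>x \<in> S\<close>, balls of radius at most the distance from \<open>x\<close> to \<open>{y, p}\<close> are the same for both
  distances, since a path through the glued point would leave them.
\<close>

lemma mtopology_glued_dist:
  assumes "y \<in> M - S" "p \<in> M - S" "S \<subseteq> M"
  shows "Metric_space.mtopology S (glued_dist y p) = subtopology mtopology S"
proof -
  interpret G: Metric_space S "glued_dist y p"
    using assms by (rule Metric_space_glued_dist)
  interpret S: Submetric M d S
    by unfold_locales (use assms in auto)
  have ball: "G.mball x r = S.sub.mball x r" if "x \<in> S" "r \<le> min (d x y) (d x p)" for x r
  proof -
    have "glued_dist y p x z < r \<longleftrightarrow> d x z < r" for z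
      unfolding glued_dist_def min_less_iff_disj
      using that(2)[unfolded min.bounded_iff] nonneg[of p z] nonneg[of y z] by linarith
    then show ?thesis by auto
  qed
  have "(\<exists>r>0. G.mball x r \<subseteq> U) \<longleftrightarrow> (\<exists>r>0. S.sub.mball x r \<subseteq> U)" if "x \<in> S" for x U
  proof -
    define c where "c = min (d x y) (d x p)"
    have c: "c > 0" using assms that by (auto simp: c_def)
    have eq: "G.mball x (min r c) = S.sub.mball x (min r c)" for r
      using that by (intro ball) (auto simp: c_def)
    have "G.mball x (min r c) \<subseteq> G.mball x r" "S.sub.mball x (min r c) \<subseteq> S.sub.mball x r" for r
      by auto
    then show ?thesis
      using c eq by (metis min_less_iff_conj order_trans)
  qed
  then have "openin G.mtopology U \<longleftrightarrow> openin S.sub.mtopology U" for U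
    unfolding G.openin_mtopology S.sub.openin_mtopology by blast
  then show ?thesis
    by (simp add: topology_eq S.mtopology_submetric)
qed

lemma glued_dist_Lipschitz:
  assumes "y \<in> M" "z \<in> M" "p \<in> M" "u \<in> M" "v \<in> M"
  shows "\<bar>glued_dist y p u v - glued_dist z p u v\<bar> \<le> d y z"
proof -
  have "\<bar>d u y - d u z\<bar> \<le> d y z" "\<bar>d y v - d z v\<bar> \<le> d y z"
    using assms mdist_reverse_triangle[of y u z] mdist_reverse_triangle[of y v z]
    by (simp_all add: commute)
  then show ?thesis by (auto simp: glued_dist_def min_def)
qed

end


section \<open>Detecting a non-closed subspace by glued metrics\<close>

lemma continuous_map_embedding_map:
  assumes "embedding_map X Y e"
  shows "continuous_map X Y e"
  using homeomorphic_imp_continuous_map[OF assms[unfolded embedding_map_def]]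
  by (rule continuous_map_into_fulltopology)

context Metric_space
begin

definition glued_metric_map :: "'b topology \<Rightarrow> ('b \<Rightarrow> 'a) \<Rightarrow> 'a \<Rightarrow> 'a \<Rightarrow> 'b \<times> 'b \<Rightarrow> real" where
  "glued_metric_map X e p y =
     restrict (\<lambda>(x, x'). glued_dist y p (e x) (e x')) (topspace X \<times> topspace X)"

lemma continuous_map_glued_metric_map:
  assumes e: "continuous_map X mtopology e" and p: "p \<in> M"
    and bdd: "\<And>u v. u \<in> M \<Longrightarrow> v \<in> M \<Longrightarrow> d u v \<le> B"
  shows "continuous_map mtopology (mtopology_of (cfunspace (prod_topology X X) euclidean_metric))
    (glued_metric_map X e p)"
proof -
  let ?F = "cfunspace (prod_topology X X) euclidean_metric"
  have eM: "e x \<in> M" if "x \<in> topspace X" for x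
    using e that by (auto simp: continuous_map_def)
  have cont_d: "continuous_map (prod_topology X X) euclideanreal (\<lambda>q. d (f q) (g q))"
    if "continuous_map (prod_topology X X) mtopology f"
      "continuous_map (prod_topology X X) mtopology g" for f g
    using continuous_map_mdist[of "prod_topology X X" Self f g] that by (simp add: mtopology_of_def)
  have proj: "continuous_map (prod_topology X X) mtopology (\<lambda>q. e (fst q))"
    "continuous_map (prod_topology X X) mtopology (\<lambda>q. e (snd q))"
    using continuous_map_compose[OF continuous_map_fst e]
      continuous_map_compose[OF continuous_map_snd e] by (simp_all add: o_def)
  have in_F: "glued_metric_map X e p y \<in> mspace ?F" if y: "y \<in> M" for y
  proof -
    have "continuous_map (prod_topology X X) euclideanreal
        (\<lambda>q. glued_dist y p (e (fst q)) (e (snd q)))"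
      unfolding glued_dist_def using y p
      by (intro continuous_map_real_min continuous_map_add cont_d proj) auto
    then have "continuous_map (prod_topology X X) euclideanreal (glued_metric_map X e p y)"
      by (rule continuous_map_eq) (auto simp: glued_metric_map_def)
    moreover have "bounded (glued_metric_map X e p y ` (topspace X \<times> topspace X))"
      unfolding bounded_iff
    proof (intro exI[of _ B] ballI)
      fix t assume "t \<in> glued_metric_map X e p y ` (topspace X \<times> topspace X)"
      then obtain x x' where x: "x \<in> topspace X" "x' \<in> topspace X"
        and t: "t = glued_dist y p (e x) (e x')"
        by (auto simp: glued_metric_map_def)
      have "0 \<le> t" "t \<le> d (e x) (e x')" by (simp_all add: t glued_dist_def)
      then show "norm t \<le> B" using bdd[OF eM eM, OF x] by simp
    qed
    ultimately show ?thesis by (simp add: glued_metric_map_def)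
  qed
  have "Lipschitz_continuous_map Self ?F (glued_metric_map X e p)"
    unfolding Lipschitz_continuous_map_def
  proof (intro conjI exI[of _ 1] ballI)
    show "glued_metric_map X e p \<in> mspace Self \<rightarrow> mspace ?F"
      using in_F by auto
    fix y z assume yz: "y \<in> mspace Self" "z \<in> mspace Self"
    show "mdist ?F (glued_metric_map X e p y) (glued_metric_map X e p z) \<le> 1 * mdist Self y z"
    proof (rule mdist_cfunspace_le)
      fix q assume "q \<in> topspace (prod_topology X X)"
      then show "mdist euclidean_metric (glued_metric_map X e p y q) (glued_metric_map X e p z q)
          \<le> 1 * mdist Self y z"
        using glued_dist_Lipschitz[of y z p] yz p eM
        by (auto simp: glued_metric_map_def dist_real_def)
    qed simp
  qed
  from Lipschitz_continuous_imp_continuous_map[OF this] show ?thesis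
    by (simp only: mtopology_of_def mspace_Self mdist_Self)
qed

lemma glued_metric_map_admissible:
  assumes e: "embedding_map X mtopology e"
    and p: "p \<in> M - e ` topspace X" and y: "y \<in> M - e ` topspace X"
    and bdd: "\<And>u v. u \<in> M \<Longrightarrow> v \<in> M \<Longrightarrow> d u v \<le> B"
  shows "glued_metric_map X e p y \<in> bounded_admissible_metrics X"
proof -
  have eM: "e ` topspace X \<subseteq> M"
    using continuous_map_image_subset_topspace[OF continuous_map_embedding_map[OF e]] by simp
  let ?D = "\<lambda>x x'. glued_dist y p (e x) (e x')"
  have hom: "homeomorphic_map X (Metric_space.mtopology (e ` topspace X) (glued_dist y p)) e"
    using e unfolding embedding_map_def by (simp add: mtopology_glued_dist[OF y p eM])
  have "?D x x' \<le> B" if "x \<in> topspace X" "x' \<in> topspace X" for x x'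
  proof -
    have "?D x x' \<le> d (e x) (e x')" by (simp add: glued_dist_def)
    then show ?thesis using bdd[of "e x" "e x'"] that eM by force
  qed
  then show ?thesis
    unfolding bounded_admissible_metrics_def glued_metric_map_def
    using pullback_metric[OF Metric_space_glued_dist[OF y p eM] hom]
    by (intro CollectI exI[of _ ?D]) blast
qed

text \<open>
  As points \<open>e x\<close> approach \<open>p\<close>, their glued distance to \<open>e x0\<close> tends to \<open>0\<close>, by a jump that starts
  at \<open>e x0\<close> itself. An admissible metric would force \<open>x\<close> to converge to \<open>x0\<close>, but \<open>e x\<close> stays
  away from \<open>e x0\<close>, being close to \<open>p \<noteq> e x0\<close>.
\<close>

lemma glued_metric_map_not_admissible:
  assumes e: "continuous_map X mtopology e" and x0: "x0 \<in> topspace X"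
    and p: "p \<in> mtopology closure_of (e ` topspace X) - e ` topspace X"
  shows "glued_metric_map X e p (e x0) \<notin> bounded_admissible_metrics X"
proof
  assume "glued_metric_map X e p (e x0) \<in> bounded_admissible_metrics X"
  then obtain D where eq: "glued_metric_map X e p (e x0) =
        restrict (\<lambda>(x, x'). D x x') (topspace X \<times> topspace X)"
    and D: "Metric_space (topspace X) D"
    and top: "Metric_space.mtopology (topspace X) D = X"
    by (auto simp: bounded_admissible_metrics_def)
  interpret D: Metric_space "topspace X" D by fact
  have eM: "e x \<in> M" if "x \<in> topspace X" for x
    using e that by (auto simp: continuous_map_def)
  have pM: "p \<in> M" and close: "\<And>r. r > 0 \<Longrightarrow> \<exists>x\<in>topspace X. d p (e x) < r"
    using p by (auto simp: metric_closure_of)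
  define c where "c = d (e x0) p / 2"
  have c: "c > 0" using p x0 eM pM by (auto simp: c_def)
  define U where "U = {x \<in> topspace X. e x \<in> mball (e x0) c}"
  have "openin D.mtopology U"
    unfolding top U_def by (rule openin_continuous_map_preimage[OF e openin_mball])
  moreover have "x0 \<in> U" using x0 eM c by (auto simp: U_def)
  ultimately obtain r where r: "r > 0" "D.mball x0 r \<subseteq> U"
    unfolding D.openin_mtopology by blast
  obtain x where x: "x \<in> topspace X" "d p (e x) < min r c"
    using close[of "min r c"] r c by auto
  have "D x0 x = glued_dist (e x0) p (e x0) (e x)"
    using fun_cong[OF eq, of "(x0, x)"] x0 x by (simp add: glued_metric_map_def)
  also have "\<dots> \<le> d (e x0) (e x0) + d p (e x)" by (simp add: glued_dist_def)
  also have "\<dots> < r" using x eM[OF x0] by simp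
  finally have "x \<in> U" using r x x0 by auto
  then have "d (e x0) (e x) < c" by (simp add: U_def)
  moreover have "d (e x0) p \<le> d (e x0) (e x) + d p (e x)"
    using triangle[of "e x0" "e x" p] commute[of p "e x"] eM x x0 pM by simp
  ultimately show False using x by (simp add: c_def)
qed

end

lemma metrizable_space_bounded_metric:
  assumes "metrizable_space Y"
  obtains d where "Metric_space (topspace Y) d" "Metric_space.mtopology (topspace Y) d = Y"
    "\<And>u v. d u v \<le> (1::real)"
proof -
  obtain M d where M: "Metric_space M d" and Y: "Y = Metric_space.mtopology M d"
    using assms by (auto simp: metrizable_space_def)
  interpret Metric_space M d by fact
  have top: "topspace Y = M" by (simp add: Y)
  show thesis
    using that[of "capped_dist 1"] capped_dist[of 1] mtopology_capped_metric[of 1]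
    by (simp add: top Y capped_dist_def)
qed

lemma metrizable_space_mtopology_of: "metrizable_space (mtopology_of m)"
  unfolding mtopology_of_def
  by (rule Metric_space.metrizable_space_mtopology[OF Metric_space_mspace_mdist])

lemma complement_of_nonclosed_image_is_preimage_of_AM:
  assumes Y: "metrizable_space Y" and e: "embedding_map X Y e"
    and not_closed: "\<not> closedin Y (e ` topspace X)"
  obtains \<Phi> where
    "continuous_map Y (mtopology_of (cfunspace (prod_topology X X) euclidean_metric)) \<Phi>"
    "{y \<in> topspace Y. \<Phi> y \<in> topspace (AM X)} = topspace Y - e ` topspace X"
proof -
  obtain d where d: "Metric_space (topspace Y) d" and top: "Metric_space.mtopology (topspace Y) d = Y"
    and bdd: "\<And>u v. d u v \<le> 1"
    using metrizable_space_bounded_metric[OF Y] by blast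
  interpret Metric_space "topspace Y" d by fact
  have cont: "continuous_map X mtopology e"
    using e top continuous_map_embedding_map by metis
  then have "e ` topspace X \<subseteq> topspace Y"
    using continuous_map_image_subset_topspace by fastforce
  then obtain p where p: "p \<in> Y closure_of (e ` topspace X) - e ` topspace X"
    using not_closed by (metis Diff_eq_empty_iff ex_in_conv closure_of_subset_eq)
  then have pY: "p \<in> topspace Y - e ` topspace X"
    using in_closure_of by fastforce
  show thesis
  proof
    show "continuous_map Y (mtopology_of (cfunspace (prod_topology X X) euclidean_metric))
        (glued_metric_map X e p)"
      using continuous_map_glued_metric_map[OF cont, of p 1] pY bdd top by simp
    show "{y \<in> topspace Y. glued_metric_map X e p y \<in> topspace (AM X)} = topspace Y - e ` topspace X"
      unfolding topspace_AM
      using glued_metric_map_not_admissible[OF cont, of _ p]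
        glued_metric_map_admissible[of X e p _ 1] e p pY bdd top by auto
  qed
qed

theorem theorem1:
  fixes X :: "'a topology" and n :: nat
  assumes "metrizable_space X" and "n \<ge> 1"
  shows "(absolute_A TYPE(nat \<Rightarrow> 'a \<times> 'a \<Rightarrow> real) n (AM X) \<longrightarrow> absolute_M TYPE('b) n X) \<and>
         (absolute_M TYPE(nat \<Rightarrow> 'a \<times> 'a \<Rightarrow> real) n (AM X) \<longrightarrow> absolute_A TYPE('b) n X)"
proof -
  let ?F = "mtopology_of (cfunspace (prod_topology X X) euclidean_metric)"
  have F: "metrizable_space ?F"
    by (rule metrizable_space_mtopology_of)
  have "subtopology ?F (topspace (AM X)) = AM X"
    unfolding topspace_AM by (rule AM_def[symmetric])
  then have emb: "embedding_map (AM X) ?F id"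
    by (simp only: embedding_map_def image_id id_apply homeomorphic_map_id)
  have image: "e ` topspace X = topspace Y - (topspace Y - e ` topspace X)"
    if "embedding_map X Y e" for Y :: "'b topology" and e
    using continuous_map_image_subset_topspace[OF continuous_map_embedding_map[OF that]] by blast
  show ?thesis
  proof (intro conjI impI)
    assume "absolute_A TYPE(nat \<Rightarrow> 'a \<times> 'a \<Rightarrow> real) n (AM X)"
    then have "absolute_A TYPE('a \<times> 'a \<Rightarrow> real) n (AM X)"
      by (rule absolute_A_universal[OF assms(2)])
    then have "id ` topspace (AM X) \<in> borel_A ?F n"
      unfolding absolute_A_def using F emb by blast
    then have AM: "topspace (AM X) \<in> borel_A ?F n"
      by (simp only: image_id id_apply)
    show "absolute_M TYPE('b) n X"
      unfolding absolute_M_def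
    proof (intro conjI allI impI assms(1))
      fix Y :: "'b topology" and e
      assume "metrizable_space Y \<and> embedding_map X Y e"
      then have Y: "metrizable_space Y" and e: "embedding_map X Y e" by auto
      show "e ` topspace X \<in> borel_M Y n"
      proof (cases "closedin Y (e ` topspace X)")
        case True
        then show ?thesis using closedin_imp_borel_M[OF Y _ assms(2)] by blast
      next
        case False
        then obtain \<Phi> where \<Phi>: "continuous_map Y ?F \<Phi>"
          and preimage: "{y \<in> topspace Y. \<Phi> y \<in> topspace (AM X)} = topspace Y - e ` topspace X"
          by (rule complement_of_nonclosed_image_is_preimage_of_AM[OF Y e])
        have "topspace Y - e ` topspace X \<in> borel_A Y n"
          using borel_classes_preimage[OF \<Phi>, of "topspace (AM X)" n] AM
          unfolding preimage by (rule conjunct1[THEN mp])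
        then show ?thesis
          using borel_classes_complement[of "topspace Y - e ` topspace X" Y n]
          unfolding image[OF e, symmetric] by blast
      qed
    qed
  next
    assume "absolute_M TYPE(nat \<Rightarrow> 'a \<times> 'a \<Rightarrow> real) n (AM X)"
    then have "absolute_M TYPE('a \<times> 'a \<Rightarrow> real) n (AM X)"
      by (rule absolute_M_universal)
    then have "id ` topspace (AM X) \<in> borel_M ?F n"
      unfolding absolute_M_def using F emb by blast
    then have AM: "topspace (AM X) \<in> borel_M ?F n"
      by (simp only: image_id id_apply)
    show "absolute_A TYPE('b) n X"
      unfolding absolute_A_def
    proof (intro conjI allI impI assms(1))
      fix Y :: "'b topology" and e
      assume "metrizable_space Y \<and> embedding_map X Y e"
      then have Y: "metrizable_space Y" and e: "embedding_map X Y e" by auto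
      show "e ` topspace X \<in> borel_A Y n"
      proof (cases "closedin Y (e ` topspace X)")
        case True
        then show ?thesis using closedin_imp_borel_A[OF _ assms(2)] by blast
      next
        case False
        then obtain \<Phi> where \<Phi>: "continuous_map Y ?F \<Phi>"
          and preimage: "{y \<in> topspace Y. \<Phi> y \<in> topspace (AM X)} = topspace Y - e ` topspace X"
          by (rule complement_of_nonclosed_image_is_preimage_of_AM[OF Y e])
        have "topspace Y - e ` topspace X \<in> borel_M Y n"
          using borel_classes_preimage[OF \<Phi>, of "topspace (AM X)" n] AM
          unfolding preimage by (rule conjunct2[THEN mp])
        then show ?thesis
          using borel_classes_complement[of "topspace Y - e ` topspace X" Y n]
          unfolding image[OF e, symmetric] by blast
      qed
    qed
  qed
qed

end
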